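(* For all integers $t \geq 4$ and $n \geq 2t$, $\mathrm{sat}_t(n, K_3, K_4) \leq 2n + 2t - 12$; that is, there exists an $n$-vertex $K_4$-saturated graph with minimum degree exactly $t$ that contains at most $2n+2t-12$ triangles.
   Context: A graph $G$ is $K_s$-saturated if $G$ contains no copy of $K_s$ but adding any edge between two nonadjacent vertices of $G$ creates a copy of $K_s$. For graphs $H$, $F$ and integers $n,t$, $\mathrm{sat}_t(n,H,F)$ is the minimum number of copies of $H$ in an $n$-vertex $F$-saturated graph with minimum degree $t$. *)

theory Defs
  imports Main "HOL-Library.Extended_Nat"
begin

type_synonym 'a graph = "'a set \<times> 'a set set"

abbreviation verts :: "'a graph \<Rightarrow> 'a set" where
  "verts G \<equiv> fst G"

abbreviation edges :: "'a graph \<Rightarrow> 'a set set" where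
  "edges G \<equiv> snd G"

definition simple_graph :: "'a graph \<Rightarrow> bool" where
  "simple_graph G \<longleftrightarrow> finite (verts G) \<and>
     (\<forall>e\<in>edges G. \<exists>u\<in>verts G. \<exists>v\<in>verts G. u \<noteq> v \<and> e = {u, v})"

definition complete_graph :: "nat \<Rightarrow> nat graph" where
  "complete_graph s = ({..<s}, {{u, v} |u v. u < s \<and> v < s \<and> u \<noteq> v})"

definition graph_iso :: "'a graph \<Rightarrow> 'b graph \<Rightarrow> bool" where
  "graph_iso G H \<longleftrightarrow> (\<exists>f. bij_betw f (verts G) (verts H) \<and>
     (\<forall>u\<in>verts G. \<forall>v\<in>verts G. {u, v} \<in> edges G \<longleftrightarrow> {f u, f v} \<in> edges H))"

definition subgraph :: "'a graph \<Rightarrow> 'a graph \<Rightarrow> bool" where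
  "subgraph S G \<longleftrightarrow> simple_graph S \<and> verts S \<subseteq> verts G \<and> edges S \<subseteq> edges G"

text \<open>Copies are subgraphs, not necessarily induced and not labelled: each subgraph isomorphic
  to \<open>H\<close> counts once, irrespective of the automorphisms of \<open>H\<close>.\<close>

definition copies :: "'b graph \<Rightarrow> 'a graph \<Rightarrow> 'a graph set" where
  "copies H G = {S. subgraph S G \<and> graph_iso S H}"

definition add_edge :: "'a \<Rightarrow> 'a \<Rightarrow> 'a graph \<Rightarrow> 'a graph" where
  "add_edge u v G = (verts G, insert {u, v} (edges G))"

definition saturated :: "'b graph \<Rightarrow> 'a graph \<Rightarrow> bool" where
  "saturated F G \<longleftrightarrow> copies F G = {} \<and>
     (\<forall>u\<in>verts G. \<forall>v\<in>verts G. u \<noteq> v \<and> {u, v} \<notin> edges G \<longrightarrow> copies F (add_edge u v G) \<noteq> {})"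

definition degree :: "'a graph \<Rightarrow> 'a \<Rightarrow> nat" where
  "degree G v = card {e \<in> edges G. v \<in> e}"

text \<open>Only meaningful for graphs with finite nonempty vertex set.\<close>

definition min_degree :: "'a graph \<Rightarrow> nat" where
  "min_degree G = Min (degree G ` verts G)"

text \<open>The graphs over which the minimum in \<open>sat\<^sub>t(n, H, F)\<close> ranges. Every finite graph has an
  isomorphic copy with vertices in \<^typ>\<open>nat\<close>, so fixing this vertex type loses nothing.\<close>

definition sat_graphs :: "nat \<Rightarrow> nat \<Rightarrow> 'c graph \<Rightarrow> nat graph set" where
  "sat_graphs t n F = {G. simple_graph G \<and> card (verts G) = n \<and> saturated F G \<and> min_degree G = t}"

text \<open>The value is \<open>\<infinity>\<close> if there is no such graph, so a finite upper bound on it asserts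
  existence; otherwise the infimum is attained.\<close>

definition sat :: "nat \<Rightarrow> nat \<Rightarrow> 'b graph \<Rightarrow> 'c graph \<Rightarrow> enat" where
  "sat t n H F = (INF G\<in>sat_graphs t n F. enat (card (copies H G)))"

end

theory Submission
  imports Defs
begin

text \<open>Start from the complete bipartite graph with sides \<open>A\<close> of size \<open>t\<close> and \<open>B\<close> of size \<open>n - t\<close>.
  Add two disjoint edges \<open>a\<^sub>0a\<^sub>1\<close>, \<open>a\<^sub>2a\<^sub>3\<close> inside \<open>A\<close> and the 4-cycle with opposite pairs \<open>b\<^sub>0, b\<^sub>1\<close>
  and \<open>b\<^sub>2, b\<^sub>3\<close> inside \<open>B\<close>, and delete the four cross edges \<open>a\<^sub>ib\<^sub>i\<close>. Each of the eight pairs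
  of an edge in \<open>A\<close> and an edge in \<open>B\<close> loses exactly one of its cross edges, so there is
  no \<open>K\<^sub>4\<close>, but any two nonadjacent vertices still see a common edge. Every triangle has an edge inside
  one side and its apex in the other, so there are \<open>2 (n - t - 2) + 4 (t - 2) = 2 n + 2 t - 12\<close>.\<close>

section \<open>Cliques and copies of complete graphs\<close>

lemma doubleton_commute: "{a, b} = {b, a}"
  by (rule insert_commute)

definition clique :: "'a graph \<Rightarrow> 'a set \<Rightarrow> bool" where
  "clique G K \<longleftrightarrow> K \<subseteq> verts G \<and> (\<forall>u\<in>K. \<forall>v\<in>K. u \<noteq> v \<longrightarrow> {u, v} \<in> edges G)"

lemma clique_empty: "clique G {}"
  by (simp add: clique_def)

lemma clique_insert:
  "clique G (insert a K) \<longleftrightarrow> a \<in> verts G \<and> (\<forall>b\<in>K. a \<noteq> b \<longrightarrow> {a, b} \<in> edges G) \<and> clique G K"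
  by (auto simp: clique_def doubleton_commute)

definition complete_on :: "'a set \<Rightarrow> 'a graph" where
  "complete_on K = (K, {{u, v} |u v. u \<in> K \<and> v \<in> K \<and> u \<noteq> v})"

lemma complete_graph_edge_iff:
  "{i, j} \<in> edges (complete_graph s) \<longleftrightarrow> i < s \<and> j < s \<and> i \<noteq> j"
  by (auto simp: complete_graph_def doubleton_eq_iff)

lemma complete_on_edge_iff:
  "{u, v} \<in> edges (complete_on K) \<longleftrightarrow> u \<in> K \<and> v \<in> K \<and> u \<noteq> v"
  by (auto simp: complete_on_def doubleton_eq_iff)

text \<open>A copy of a complete graph is determined by its vertex set, because any two of its
  vertices are joined. Questions about copies thereby become questions about cliques.\<close>

lemma copies_complete_graph:
  "copies (complete_graph s) G = complete_on ` {K. finite K \<and> card K = s \<and> clique G K}"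
proof (intro equalityI subsetI)
  fix S assume "S \<in> copies (complete_graph s) G"
  then have sub: "simple_graph S" "verts S \<subseteq> verts G" "edges S \<subseteq> edges G"
    and "graph_iso S (complete_graph s)"
    by (auto simp: copies_def subgraph_def)
  then obtain f where bij: "bij_betw f (verts S) {..<s}"
    and f: "\<And>u v. u \<in> verts S \<Longrightarrow> v \<in> verts S \<Longrightarrow>
      {u, v} \<in> edges S \<longleftrightarrow> {f u, f v} \<in> edges (complete_graph s)"
    by (auto simp: graph_iso_def complete_graph_def)
  have edge: "{u, v} \<in> edges S \<longleftrightarrow> u \<noteq> v" if "u \<in> verts S" "v \<in> verts S" for u v
    using f[OF that] bij_betw_apply[OF bij] bij_betw_imp_inj_on[OF bij] that
    by (auto simp: complete_graph_edge_iff inj_on_eq_iff)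
  have "edges S = {{u, v} |u v. u \<in> verts S \<and> v \<in> verts S \<and> u \<noteq> v}"
    using sub(1) edge by (fastforce simp: simple_graph_def)
  then have "S = complete_on (verts S)"
    by (simp add: complete_on_def prod_eq_iff)
  moreover have "finite (verts S)" "card (verts S) = s"
    using sub(1) bij_betw_same_card[OF bij] by (auto simp: simple_graph_def)
  moreover have "clique G (verts S)"
    using sub edge by (auto simp: clique_def)
  ultimately show "S \<in> complete_on ` {K. finite K \<and> card K = s \<and> clique G K}"
    by blast
next
  fix S assume "S \<in> complete_on ` {K. finite K \<and> card K = s \<and> clique G K}"
  then obtain K where K: "finite K" "card K = s" "clique G K" and S: "S = complete_on K"
    by blast
  obtain f where bij: "bij_betw f K {..<s}"
    using ex_bij_betw_finite_nat[OF K(1)] K(2) by (auto simp: atLeast0LessThan)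
  have "graph_iso S (complete_graph s)"
    unfolding graph_iso_def S
  proof (intro exI conjI ballI)
    show "bij_betw f (verts (complete_on K)) (verts (complete_graph s))"
      using bij by (simp add: complete_on_def complete_graph_def)
  next
    fix u v assume "u \<in> verts (complete_on K)" "v \<in> verts (complete_on K)"
    then have uv: "u \<in> K" "v \<in> K"
      by (auto simp: complete_on_def)
    then show "{u, v} \<in> edges (complete_on K) \<longleftrightarrow> {f u, f v} \<in> edges (complete_graph s)"
      using bij_betw_apply[OF bij] bij_betw_imp_inj_on[OF bij]
      by (auto simp: complete_on_edge_iff complete_graph_edge_iff inj_on_eq_iff)
  qed
  moreover have "subgraph S G"
    using K(1,3) by (auto simp: S subgraph_def simple_graph_def clique_def complete_on_def)
  ultimately show "S \<in> copies (complete_graph s) G"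
    by (simp add: copies_def)
qed

section \<open>Sorted listings of small sets\<close>

text \<open>Listing a clique in increasing order leaves a single possible direction for each of its
  arcs, which keeps the later case analyses short.\<close>

lemma card_Suc_obtain_least:
  fixes K :: "'a :: linorder set"
  assumes "card K = Suc m"
  obtains w L where "K = insert w L" "\<And>x. x \<in> L \<Longrightarrow> w < x" "card L = m"
proof
  have fin: "finite K" and ne: "K \<noteq> {}"
    using assms card.infinite by fastforce+
  show "K = insert (Min K) (K - {Min K})"
    using Min_in[OF fin ne] by blast
  show "Min K < x" if "x \<in> K - {Min K}" for x
    using that Min_le[OF fin] by (metis Diff_iff insertI1 order_le_less)
  show "card (K - {Min K}) = m"
    using assms Min_in[OF fin ne] by simp
qed

lemma card_3_obtain_sorted:
  fixes K :: "'a :: linorder set"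
  assumes "card K = 3"
  obtains w x y where "K = {w, x, y}" "w < x" "x < y"
proof -
  obtain w L where 1: "K = insert w L" "\<And>x. x \<in> L \<Longrightarrow> w < x" "card L = 2"
    using card_Suc_obtain_least[of K 2] assms by (auto simp: eval_nat_numeral)
  obtain x M where 2: "L = insert x M" "\<And>y. y \<in> M \<Longrightarrow> x < y" "card M = 1"
    using card_Suc_obtain_least[of L 1] 1(3) by (auto simp: eval_nat_numeral)
  then obtain y where "M = {y}"
    by (auto simp: card_1_singleton_iff)
  with 1 2 that[of w x y] show thesis
    by simp
qed

lemma card_4_obtain_sorted:
  fixes K :: "'a :: linorder set"
  assumes "card K = 4"
  obtains w x y z where "K = {w, x, y, z}" "w < x" "x < y" "y < z"
proof -
  obtain w L where 1: "K = insert w L" "\<And>x. x \<in> L \<Longrightarrow> w < x" "card L = 3"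
    using card_Suc_obtain_least[of K 3] assms by (auto simp: eval_nat_numeral)
  obtain x y z where "L = {x, y, z}" "x < y" "y < z"
    using card_3_obtain_sorted[OF 1(3)] .
  with 1 that[of w x y z] show thesis
    by simp
qed

section \<open>The extremal graph\<close>

text \<open>Here \<open>A\<close> is \<open>{..<t}\<close> and \<open>B\<close> is
  \<open>{t..<n}\<close>, with \<open>i\<close> in the role of \<open>a\<^sub>i\<close> and
  \<open>t + i\<close> in that of \<open>b\<^sub>i\<close> for \<open>i < 4\<close>. Each edge is
  oriented from its smaller to its larger end.\<close>

definition arc :: "nat \<Rightarrow> nat \<Rightarrow> nat \<Rightarrow> nat \<Rightarrow> bool" where
  "arc t n u v \<longleftrightarrow> u = 0 \<and> v = 1 \<or> u = 2 \<and> v = 3 \<or>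
     (u = t \<or> u = t + 1) \<and> (v = t + 2 \<or> v = t + 3) \<or>
     u < t \<and> t \<le> v \<and> v < n \<and> \<not> (u < 4 \<and> v = t + u)"

definition extremal_graph :: "nat \<Rightarrow> nat \<Rightarrow> nat graph" where
  "extremal_graph t n = ({..<n}, {{u, v} |u v. arc t n u v})"

section \<open>Degrees as sizes of neighbourhoods\<close>

definition neighbours :: "'a graph \<Rightarrow> 'a \<Rightarrow> 'a set" where
  "neighbours G v = {u. {v, u} \<in> edges G}"

lemma degree_eq_card_neighbours:
  assumes "simple_graph G"
  shows "degree G v = card (neighbours G v)"
proof -
  have "{e \<in> edges G. v \<in> e} = (\<lambda>u. {v, u}) ` neighbours G v"
  proof (intro equalityI subsetI)
    fix e assume e: "e \<in> {e \<in> edges G. v \<in> e}"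
    then obtain a b where "e = {a, b}"
      using assms by (auto simp: simple_graph_def)
    \<comment> \<open>The conditional picks the end of \<open>e\<close> other than
      \<open>v\<close>.\<close>
    with e have "e = {v, if v = a then b else a}"
      by auto
    with e show "e \<in> (\<lambda>u. {v, u}) ` neighbours G v"
      by (auto simp only: neighbours_def)
  qed (auto simp: neighbours_def)
  moreover have "inj_on (\<lambda>u. {v, u}) (neighbours G v)"
    by (auto simp: inj_on_def doubleton_eq_iff)
  ultimately show ?thesis
    by (simp add: degree_def card_image)
qed

lemma finite_neighbours:
  assumes "simple_graph G"
  shows "finite (neighbours G v)"
proof (rule finite_subset)
  show "neighbours G v \<subseteq> verts G"
  proof
    fix u assume "u \<in> neighbours G v"
    then obtain a b where "a \<in> verts G" "b \<in> verts G" "{v, u} = {a, b}"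
      using assms by (auto simp: neighbours_def simple_graph_def)
    then show "u \<in> verts G"
      by (auto simp: doubleton_eq_iff)
  qed
  show "finite (verts G)"
    using assms by (simp add: simple_graph_def)
qed

section \<open>Adjacency according to the sides of the two ends\<close>

lemma verts_extremal_graph [simp]: "verts (extremal_graph t n) = {..<n}"
  by (simp add: extremal_graph_def)

lemma edge_extremal_graph_iff:
  "{u, v} \<in> edges (extremal_graph t n) \<longleftrightarrow> arc t n u v \<or> arc t n v u"
  by (auto simp: extremal_graph_def doubleton_eq_iff)

context
  fixes t n :: nat
  assumes t: "t \<ge> 4" and n: "n \<ge> 2 * t"
begin

lemma arc_low: "v < t \<Longrightarrow> arc t n u v \<longleftrightarrow> u = 0 \<and> v = 1 \<or> u = 2 \<and> v = 3"
  by (auto simp: arc_def)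

lemma arc_high:
  "t \<le> u \<Longrightarrow> arc t n u v \<longleftrightarrow> (u = t \<or> u = t + 1) \<and> (v = t + 2 \<or> v = t + 3)"
  using t by (auto simp: arc_def)

lemma arc_cross:
  "u < t \<Longrightarrow> t \<le> v \<Longrightarrow> arc t n u v \<longleftrightarrow> v < n \<and> (u < 4 \<longrightarrow> v \<noteq> t + u)"
  using t by (auto simp: arc_def)

lemma arc_less: "arc t n u v \<Longrightarrow> u < v"
  using t n by (auto simp: arc_def)

lemma arc_less_n: "arc t n u v \<Longrightarrow> v < n"
  using t n by (auto simp: arc_def)

lemma edge_extremal_graph_less_iff:
  "u < v \<Longrightarrow> {u, v} \<in> edges (extremal_graph t n) \<longleftrightarrow> arc t n u v"
  using arc_less by (auto simp: edge_extremal_graph_iff dest: less_asym)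

lemma simple_extremal_graph: "simple_graph (extremal_graph t n)"
  unfolding simple_graph_def
proof (intro conjI ballI)
  fix e assume "e \<in> edges (extremal_graph t n)"
  then obtain u v where e: "e = {u, v}" and arc: "arc t n u v"
    by (auto simp: extremal_graph_def)
  show "\<exists>u\<in>verts (extremal_graph t n). \<exists>v\<in>verts (extremal_graph t n). u \<noteq> v \<and> e = {u, v}"
    by (intro bexI[of _ u] bexI[of _ v]) (use arc_less[OF arc] arc_less_n[OF arc] e in auto)
qed simp

section \<open>Saturation\<close>

text \<open>Neither side contains two consecutive arcs, so a sorted 4-clique has exactly two
  vertices in each side. It then consists of an edge in \<open>A\<close> and an edge in
  \<open>B\<close>, and such a pair always lacks a cross edge.\<close>

lemma no_K4_extremal_graph: "copies (complete_graph 4) (extremal_graph t n) = {}"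
proof -
  have False if K: "card K = 4" and clique: "clique (extremal_graph t n) K" for K
  proof -
    obtain w x y z where sorted: "K = {w, x, y, z}" "w < x" "x < y" "y < z"
      using card_4_obtain_sorted[OF K] .
    then have arcs: "arc t n w x" "arc t n w y" "arc t n w z" "arc t n x y" "arc t n x z" "arc t n y z"
      using clique by (simp_all add: clique_def edge_extremal_graph_less_iff)
    consider "y < t" | "x < t" "t \<le> y" | "t \<le> x"
      by linarith
    then show False
    proof cases
      case 1
      then show False
        using arcs(1,4) sorted by (simp add: arc_low)
    next
      case 2
      then have "w = 0 \<and> x = 1 \<or> w = 2 \<and> x = 3"
        using arcs(1) by (simp add: arc_low)
      moreover have "(y = t \<or> y = t + 1) \<and> (z = t + 2 \<or> z = t + 3)"
        using arcs(6) 2 by (simp add: arc_high)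
      \<comment> \<open>If \<open>w\<close>, \<open>x\<close> are 0, 1, this excludes both values of
        \<open>y\<close>; if they are 2, 3, it excludes both values of \<open>z\<close>.\<close>
      moreover have "y \<noteq> t + w" "z \<noteq> t + w" "y \<noteq> t + x" "z \<noteq> t + x"
        using arcs 2 sorted calculation t by (auto simp: arc_cross)
      ultimately show False
        by auto
    next
      case 3
      then show False
        using arcs(4,6) sorted by (auto simp: arc_high)
    qed
  qed
  then show ?thesis
    by (auto simp: copies_complete_graph)
qed

text \<open>Two vertices in one side see an edge of the other side that avoids their deleted
  partners. For a deleted pair, the common edge is a cross edge.\<close>

lemma common_edge:
  assumes uv: "u < v" "v < n" "\<not> arc t n u v"
  obtains p q where "arc t n p q" "arc t n u p \<or> arc t n p u" "arc t n u q \<or> arc t n q u"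
    "arc t n v p \<or> arc t n p v" "arc t n v q \<or> arc t n q v"
proof -
  consider (A) "v < t" | (B) "t \<le> u" | (cross) "u < 4" "v = t + u"
    using uv by (auto simp: arc_def)
  then show thesis
  proof cases
    case A
    \<comment> \<open>The cycle edge \<open>pq\<close> must miss \<open>t + u\<close> and
      \<open>t + v\<close>. The defaults \<open>t\<close> and \<open>t + 2\<close> are changed only
      when they are such a partner; the replacement is safe because 0, 1 and 2, 3 are adjacent
      pairs.\<close>
    define p where "p = (if u = 0 then t + 1 else t)"
    define q where "q = (if u = 2 \<or> v = 2 then t + 3 else t + 2)"
    have p: "p = t \<or> p = t + 1" "p \<noteq> t + u" "p \<noteq> t + v"
      using A uv by (auto simp: p_def arc_low)
    have q: "q = t + 2 \<or> q = t + 3" "q \<noteq> t + u" "q \<noteq> t + v"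
      using A uv by (auto simp: q_def arc_low)
    have "t \<le> p" "t \<le> q" "p < n" "q < n" "u < t"
      using p(1) q(1) t n A uv(1) by linarith+
    then show thesis
      using p q A by (intro that[of p q]) (simp_all add: arc_high arc_cross)
  next
    case B
    show thesis
    \<comment> \<open>If \<open>u\<close> is \<open>t\<close> or \<open>t + 1\<close>, neither
      vertex is a partner of 2 or 3, so the edge 2, 3 serves. Otherwise both vertices exceed
      \<open>t + 1\<close>, and the edge 0, 1 serves.\<close>
    proof (cases "u = t \<or> u = t + 1")
      case True
      then have "v \<noteq> t + 2" "v \<noteq> t + 3"
        using uv(3) by (auto simp: arc_high)
      then show thesis
        using True B uv(1,2) t by (intro that[of 2 3]) (auto simp: arc_low arc_cross)
    next
      case False
      then have "u \<noteq> t" "u \<noteq> t + 1" "v \<noteq> t" "v \<noteq> t + 1"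
        using B uv(1) by auto
      then show thesis
        using B uv(1,2) t by (intro that[of 0 1]) (auto simp: arc_low arc_cross)
    qed
  next
    case cross
    \<comment> \<open>In each case \<open>p\<close> is the neighbour of \<open>u\<close> inside
      \<open>A\<close>, and \<open>q\<close> is a neighbour of \<open>v\<close> on the
      4-cycle.\<close>
    consider "u = 0" | "u = 1" | "u = 2" | "u = 3"
      using cross(1) by linarith
    then show thesis
    proof cases
      case 1
      then show thesis
        using cross(2) t n by (intro that[of 1 "t + 2"]) (simp_all add: arc_low arc_high arc_cross)
    next
      case 2
      then show thesis
        using cross(2) t n by (intro that[of 0 "t + 2"]) (simp_all add: arc_low arc_high arc_cross)
    next
      case 3
      then show thesis
        using cross(2) t n by (intro that[of 3 t]) (simp_all add: arc_low arc_high arc_cross)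
    next
      case 4
      then show thesis
        using cross(2) t n by (intro that[of 2 t]) (simp_all add: arc_low arc_high arc_cross)
    qed
  qed
qed

lemma add_edge_extremal_graph:
  assumes uv: "u < v" "v < n" "\<not> arc t n u v"
  shows "copies (complete_graph 4) (add_edge u v (extremal_graph t n)) \<noteq> {}"
proof -
  obtain p q where pq: "arc t n p q" "arc t n u p \<or> arc t n p u" "arc t n u q \<or> arc t n q u"
    "arc t n v p \<or> arc t n p v" "arc t n v q \<or> arc t n q v"
    using common_edge[OF uv] .
  then have "p \<noteq> q" "u \<noteq> p" "u \<noteq> q" "v \<noteq> p" "v \<noteq> q"
    by (metis arc_less less_irrefl)+
  then have card: "card {u, v, p, q} = 4"
    using uv(1) by simp
  have "p < n" "q < n"
    using arc_less[OF pq(1)] arc_less_n[OF pq(1)] by auto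
  moreover have "{{u, p}, {u, q}, {v, p}, {v, q}, {p, q}} \<subseteq> edges (extremal_graph t n)"
    unfolding insert_subset edge_extremal_graph_iff using pq by blast
  ultimately have "clique (add_edge u v (extremal_graph t n)) {u, v, p, q}"
    using uv(1,2) by (simp add: clique_insert clique_empty add_edge_def)
  then have "{u, v, p, q} \<in> {K. finite K \<and> card K = 4 \<and> clique (add_edge u v (extremal_graph t n)) K}"
    using card by simp
  then show ?thesis
    unfolding copies_complete_graph by blast
qed

lemma saturated_extremal_graph: "saturated (complete_graph 4) (extremal_graph t n)"
  unfolding saturated_def
proof (intro conjI ballI impI no_K4_extremal_graph)
  fix u v
  assume "u \<in> verts (extremal_graph t n)" "v \<in> verts (extremal_graph t n)"
    and nonadj: "u \<noteq> v \<and> {u, v} \<notin> edges (extremal_graph t n)"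
  then have "u < n" "v < n" "\<not> arc t n u v" "\<not> arc t n v u"
    by (auto simp: edge_extremal_graph_iff)
  moreover have "add_edge u v (extremal_graph t n) = add_edge v u (extremal_graph t n)"
    by (simp add: add_edge_def doubleton_commute)
  ultimately show "copies (complete_graph 4) (add_edge u v (extremal_graph t n)) \<noteq> {}"
    using add_edge_extremal_graph[of u v] add_edge_extremal_graph[of v u] nonadj
    by (metis linorder_neqE_nat)
qed

section \<open>Minimum degree\<close>

lemma neighbours_extremal_graph:
  "u \<in> neighbours (extremal_graph t n) v \<longleftrightarrow> arc t n v u \<or> arc t n u v"
  by (simp add: neighbours_def edge_extremal_graph_iff)

text \<open>A vertex that loses a cross edge regains a neighbour inside its own side; every other
  vertex sees the whole opposite side. Both sides have at least \<open>t\<close> vertices.\<close>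

lemma degree_extremal_graph_ge:
  assumes "v < n"
  shows "t \<le> degree (extremal_graph t n) v"
proof -
  have le: "t \<le> degree (extremal_graph t n) v"
    if "N \<subseteq> neighbours (extremal_graph t n) v" "t \<le> card N" for N
    using card_mono[OF finite_neighbours[OF simple_extremal_graph] that(1)] that(2)
    by (simp add: degree_eq_card_neighbours[OF simple_extremal_graph])
  consider (a) "v < 4" | (A) "4 \<le> v" "v < t" | (b) "t \<le> v" "v < t + 4" | (B) "t + 4 \<le> v"
    by linarith
  then show ?thesis
  proof cases
    case a
    then have "v = 0 \<or> v = 1 \<or> v = 2 \<or> v = 3"
      by linarith
    then obtain p where p: "p < t" "arc t n v p \<or> arc t n p v"
    proof (elim disjE)
      assume "v = 0" with t show thesis by (intro that[of 1]) (simp_all add: arc_low)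
    next
      assume "v = 1" with t show thesis by (intro that[of 0]) (simp_all add: arc_low)
    next
      assume "v = 2" with t show thesis by (intro that[of 3]) (simp_all add: arc_low)
    next
      assume "v = 3" with t show thesis by (intro that[of 2]) (simp_all add: arc_low)
    qed
    show ?thesis
    proof (rule le)
      show "insert p ({t..<n} - {t + v}) \<subseteq> neighbours (extremal_graph t n) v"
        using a t p(2) by (auto simp: neighbours_extremal_graph arc_cross)
      show "t \<le> card (insert p ({t..<n} - {t + v}))"
        using a t n p(1) by (simp add: card_insert_if card_Diff_singleton)
    qed
  next
    case A
    show ?thesis
    proof (rule le)
      show "{t..<n} \<subseteq> neighbours (extremal_graph t n) v"
        using A by (auto simp: neighbours_extremal_graph arc_cross)
    qed (use n in simp)
  next
    case b
    then obtain q where q: "t \<le> q" "arc t n v q \<or> arc t n q v"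
      by (cases "v \<le> t + 1") (rule that[of "t + 2"] that[of t]; force simp: arc_high)+
    show ?thesis
    proof (rule le)
      show "insert q ({..<t} - {v - t}) \<subseteq> neighbours (extremal_graph t n) v"
        using b q(2) assms by (auto simp: neighbours_extremal_graph arc_cross)
      show "t \<le> card (insert q ({..<t} - {v - t}))"
        using b t q(1) by (simp add: card_insert_if card_Diff_singleton)
    qed
  next
    case B
    show ?thesis
    proof (rule le)
      show "{..<t} \<subseteq> neighbours (extremal_graph t n) v"
        using B assms by (auto simp: neighbours_extremal_graph arc_cross)
    qed simp
  qed
qed

text \<open>A vertex of \<open>B\<close> off the 4-cycle has degree \<open>t\<close>, but none
  exists when \<open>t = 4\<close> and \<open>n = 8\<close>. For \<open>n = 2 * t\<close> the vertex
  0 is used instead, its degree being \<open>n - t\<close>.\<close>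

lemma degree_extremal_graph_eq: "\<exists>v<n. degree (extremal_graph t n) v = t"
proof (cases "n = 2 * t")
  case True
  have "neighbours (extremal_graph t n) 0 = insert 1 {t + 1..<n}"
  proof (rule set_eqI)
    fix u
    show "u \<in> neighbours (extremal_graph t n) 0 \<longleftrightarrow> u \<in> insert 1 {t + 1..<n}"
      using t by (cases "u < t") (auto simp: neighbours_extremal_graph arc_low arc_cross arc_high)
  qed
  then have "degree (extremal_graph t n) 0 = card (insert 1 {t + 1..<n})"
    by (simp only: degree_eq_card_neighbours[OF simple_extremal_graph])
  then have "degree (extremal_graph t n) 0 = t"
    using True t by simp
  then show ?thesis
    using n t by (intro exI[of _ 0]) simp
next
  case False
  define m where "m = n - 1"
  have m: "m < n" "t + 4 \<le> m"
    using False t n by (auto simp: m_def)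
  have "arc t n m u \<or> arc t n u m \<longleftrightarrow> u < t" for u
  proof (cases "u < t")
    case True
    then show ?thesis
      using m by (simp add: arc_cross)
  next
    case False
    then show ?thesis
      using m by (simp add: arc_high)
  qed
  then have "neighbours (extremal_graph t n) m = {..<t}"
    unfolding set_eq_iff neighbours_extremal_graph lessThan_iff by blast
  then have "degree (extremal_graph t n) m = t"
    by (simp add: degree_eq_card_neighbours[OF simple_extremal_graph])
  then show ?thesis
    using m(1) by blast
qed

lemma min_degree_extremal_graph: "min_degree (extremal_graph t n) = t"
  unfolding min_degree_def
  using degree_extremal_graph_ge degree_extremal_graph_eq
  by (intro Min_eqI) (auto intro: rev_image_eqI)

section \<open>Counting triangles\<close>

text \<open>Each entry holds an edge inside one side together with its possible apexes: the opposite
  side minus the deleted partners of the two ends.\<close>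

definition triangle_bases :: "(nat \<times> nat \<times> nat set) set" where
  "triangle_bases = {(0, 1, {t..<n} - {t, t + 1}), (2, 3, {t..<n} - {t + 2, t + 3}),
     (t, t + 2, {..<t} - {0, 2}), (t, t + 3, {..<t} - {0, 3}),
     (t + 1, t + 2, {..<t} - {1, 2}), (t + 1, t + 3, {..<t} - {1, 3})}"

text \<open>The middle vertex \<open>x\<close> decides the base. In \<open>A\<close> it forms the
  base with \<open>w\<close>, in \<open>B\<close> with \<open>y\<close>; the third vertex lies
  opposite, as no side has two consecutive arcs.\<close>

lemma triangle_extremal_graph:
  assumes K: "card K = 3" and clique: "clique (extremal_graph t n) K"
  shows "K \<in> (\<Union>(p, q, C)\<in>triangle_bases. (\<lambda>r. {p, q, r}) ` C)"
proof -
  obtain w x y where sorted: "K = {w, x, y}" "w < x" "x < y"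
    using card_3_obtain_sorted[OF K] .
  then have arcs: "arc t n w x" "arc t n w y" "arc t n x y"
    using clique by (simp_all add: clique_def edge_extremal_graph_less_iff)
  show ?thesis
  proof (cases "x < t")
    case True
    then have base: "w = 0 \<and> x = 1 \<or> w = 2 \<and> x = 3"
      using arcs(1) by (simp add: arc_low)
    then have "\<not> y < t"
      using sorted(3) arcs(3) arc_low[of y x] by auto
    with base have "w < 4" "x < 4" "w < t" "t \<le> y"
      using True by auto
    then have "y < n" "y \<noteq> t + w" "y \<noteq> t + x"
      using arcs(2,3) True by (simp_all add: arc_cross)
    then have "y \<in> {t..<n} - {t + w, t + x}"
      using \<open>t \<le> y\<close> by simp
    moreover have "(w, x, {t..<n} - {t + w, t + x}) \<in> triangle_bases"
      using base by (elim disjE conjE) (simp_all add: triangle_bases_def)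
    ultimately show ?thesis
      unfolding sorted(1) by blast
  next
    case False
    then have base: "(x = t \<or> x = t + 1) \<and> (y = t + 2 \<or> y = t + 3)"
      using arcs(3) by (simp add: arc_high)
    then have "w < t"
      using arcs(1) arc_high[of w x] by fastforce
    then have "w < t" "w < 4 \<Longrightarrow> x \<noteq> t + w" "w < 4 \<Longrightarrow> y \<noteq> t + w"
      using arcs(1,2) False sorted(3) by (simp_all add: arc_cross)
    then have "w \<in> {..<t} - {x - t, y - t}"
      using base by auto
    moreover have "(x, y, {..<t} - {x - t, y - t}) \<in> triangle_bases"
      using base by (elim disjE conjE) (simp_all add: triangle_bases_def)
    moreover have "K = {x, y, w}"
      using sorted(1) by auto
    ultimately show ?thesis
      by blast
  qed
qed

text \<open>A union bound over the six bases suffices for an upper estimate.\<close>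

lemma card_triangles_extremal_graph:
  "card (copies (complete_graph 3) (extremal_graph t n)) \<le> 2 * n + 2 * t - 12"
proof -
  let ?U = "\<Union>(p, q, C)\<in>triangle_bases. (\<lambda>r. {p, q, r}) ` C"
  have fin: "finite ?U"
    by (auto simp: triangle_bases_def)
  have sub: "{K. finite K \<and> card K = 3 \<and> clique (extremal_graph t n) K} \<subseteq> ?U"
    using triangle_extremal_graph by blast
  have "card (copies (complete_graph 3) (extremal_graph t n)) \<le> card ?U"
    unfolding copies_complete_graph
    using card_image_le[OF finite_subset[OF sub fin]] card_mono[OF fin sub] order_trans by blast
  also have "\<dots> \<le> (\<Sum>(p, q, C)\<in>triangle_bases. card ((\<lambda>r. {p, q, r}) ` C))"
    using card_UN_le[of triangle_bases "\<lambda>(p, q, C). (\<lambda>r. {p, q, r}) ` C"]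
    by (simp add: triangle_bases_def case_prod_unfold)
  also have "\<dots> \<le> (\<Sum>(p, q, C)\<in>triangle_bases. card C)"
    by (intro sum_mono) (auto simp: triangle_bases_def intro!: card_image_le)
  \<comment> \<open>The six triples are distinct, with two apex sets of size
    \<open>n - t - 2\<close> and four of size \<open>t - 2\<close>. The bounds on \<open>t\<close>
    and \<open>n\<close> keep the natural-number subtractions from truncating.\<close>
  also have "\<dots> = 2 * n + 2 * t - 12"
    using t n by (simp add: triangle_bases_def card_Diff_subset)
  finally show ?thesis .
qed

end

section \<open>The bound on the saturation number\<close>

theorem theorem2:
  fixes t n :: nat
  assumes "t \<ge> 4" and "n \<ge> 2 * t"
  shows "sat t n (complete_graph 3) (complete_graph 4) \<le> enat (2 * n + 2 * t - 12) \<and>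
    (\<exists>G :: nat graph. simple_graph G \<and> card (verts G) = n \<and> saturated (complete_graph 4) G \<and>
       min_degree G = t \<and> card (copies (complete_graph 3) G) \<le> 2 * n + 2 * t - 12)"
proof -
  let ?G = "extremal_graph t n"
  note props = simple_extremal_graph[OF assms] saturated_extremal_graph[OF assms]
    min_degree_extremal_graph[OF assms] card_triangles_extremal_graph[OF assms]
  have "?G \<in> sat_graphs t n (complete_graph 4)"
    using props by (simp add: sat_graphs_def)
  then have "sat t n (complete_graph 3) (complete_graph 4) \<le>
      enat (card (copies (complete_graph 3) ?G))"
    unfolding sat_def by (rule INF_lower)
  also have "\<dots> \<le> enat (2 * n + 2 * t - 12)"
    using props(4) by simp
  finally show ?thesis
    using props by (intro conjI exI[of _ ?G]) simp_all
qed

end
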